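(* For positive even integers $m_0\neq 16$, let $$t(m_0)=\frac{m_0^6}{9}+\frac{5m_0^5}{2}+\frac{187m_0^4}{9}+\frac{244m_0^3}{3}+\frac{1468m_0^2}{9}+\frac{488m_0}{3}+64$$ and $\omega(m_0)=\log_{m_0^2}t(m_0)$. Then the minimum of $\omega(m_0)$ over all positive even integers $m_0\neq 16$ is attained at $m_0=44$, that is, for base case $n_0=m_0^2=44^2=1936$, and it equals $\omega(44)=\log_{1936}1303676064\approx 2.773177$ (rounded to six decimal places).
   Context: The number $t(m_0)$ is the number of multiplications used by the $n_0\times n_0$ base case, $n_0=m_0^2$, of a family of recursive bilinear matrix multiplication algorithms indexed by positive even integers $m_0\neq 16$. Applying the algorithm with base case $n_0=m_0^2$ recursively gives an $n\times n$ matrix multiplication algorithm of complexity $O(n^{\omega(m_0)})$, so $\omega(m_0)$ is called the exponent of the algorithm, and the optimal exponent of the family is the minimum of $\omega(m_0)$. *)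

theory Defs
  imports Complex_Main
begin

definition t :: "nat \<Rightarrow> real" where
  "t m = real m ^ 6 / 9 + 5 * real m ^ 5 / 2 + 187 * real m ^ 4 / 9 + 244 * real m ^ 3 / 3
       + 1468 * real m ^ 2 / 9 + 488 * real m / 3 + 64"

definition omega :: "nat \<Rightarrow> real" where
  "omega m = log (real m ^ 2) (t m)"

end

theory Submission
  imports Defs "HOL-Analysis.Analysis"
begin

text \<open>
  In the variable \<open>x = ln m\<close>, the quotient \<open>t m / m powr s\<close> is a nonnegative combination of
  exponentials, hence convex, for every real \<open>s\<close>. With \<open>s = 538/97\<close>, a convergent of
  the continued fraction of \<open>2 * omega 44\<close>, it is less than 1 at 44 and greater than 1 at the
  two even neighbours 42 and 46. By convexity it exceeds 1 at every other positive even \<open>m\<close>, so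
  \<open>omega 44 < 269/97 < omega m\<close>.
\<close>

text \<open>Each summand has second derivative \<open>c k * (a k)\<^sup>2 * exp (a k * x)\<close>,
  nonnegative whatever the sign of \<open>a k\<close>; in \<open>h\<close> the rates
  \<open>k - 538/97\<close> are negative for all \<open>k\<close> except 6.\<close>

lemma convex_on_sum_exp:
  fixes c a :: "'i \<Rightarrow> real"
  assumes "finite A" and "\<And>k. k \<in> A \<Longrightarrow> 0 \<le> c k"
  shows "convex_on UNIV (\<lambda>x. \<Sum>k\<in>A. c k * exp (a k * x))"
proof -
  have "convex_on UNIV (\<lambda>x. c k * exp (a k * x))" if "k \<in> A" for k
    using assms(2)[OF that]
    by (intro f''_ge0_imp_convex[where f' = "\<lambda>x. c k * (a k * exp (a k * x))"
          and f'' = "\<lambda>x. c k * ((a k)\<^sup>2 * exp (a k * x))"])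
       (auto intro!: derivative_eq_intros simp: power2_eq_square)
  then show ?thesis
    using assms(1)
    by (induction A rule: infinite_finite_induct)
       (auto intro!: convex_on_add simp: convex_on_const)
qed

text \<open>If \<open>f x\<close> were below \<open>f a\<close> too, convexity would bound
  \<open>f a\<close> by a weighted average of two smaller values. So a lower bound at
  \<open>a\<close> extends to points beyond \<open>a\<close>, away from \<open>b\<close>.\<close>

lemma convex_on_le_beyond:
  fixes f :: "'a::real_vector \<Rightarrow> real"
  assumes "convex_on S f" "b \<in> S" "x \<in> S" "a \<in> closed_segment b x" "f b < f a"
  shows "f a \<le> f x"
proof (rule ccontr)
  assume "\<not> f a \<le> f x"
  obtain u where u: "0 \<le> u" "u \<le> 1" "a = (1 - u) *\<^sub>R b + u *\<^sub>R x"
    using assms(4) by (auto simp: in_segment)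
  have "f a \<le> (1 - u) * f b + u * f x"
    using convex_onD[OF assms(1) u(1,2) assms(2,3)] u(3) by simp
  also have "\<dots> < f a"
    using u(1,2) assms(5) \<open>\<not> f a \<le> f x\<close> by (intro convex_bound_lt) auto
  finally show False by simp
qed

definition t_coeffs :: "real list" where
  "t_coeffs = [64, 488/3, 1468/9, 244/3, 187/9, 5/2, 1/9]"

lemma t_eq_sum: "t m = (\<Sum>k\<le>6. t_coeffs ! k * real m ^ k)"
proof -
  have *: "{..6} = {0, 1, 2, 3, 4, 5, 6::nat}"
    by auto
  show ?thesis
    unfolding * t_def t_coeffs_def by simp
qed

lemma t_coeffs_nonneg: "k \<le> 6 \<Longrightarrow> 0 \<le> t_coeffs ! k"
proof -
  assume "k \<le> 6"
  then have "t_coeffs ! k \<in> set t_coeffs"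
    by (intro nth_mem) (simp add: t_coeffs_def)
  then show ?thesis
    by (auto simp: t_coeffs_def)
qed

definition h :: "real \<Rightarrow> real" where
  "h x = (\<Sum>k\<le>6. t_coeffs ! k * exp ((real k - 538/97) * x))"

lemma convex_h: "convex_on UNIV h"
  unfolding h_def by (intro convex_on_sum_exp t_coeffs_nonneg) simp_all

lemma t_pos: "t m > 0"
  unfolding t_def by (intro add_nonneg_pos) auto

text \<open>The sign of the exponent decides whether \<open>h (ln m)\<close> is below or above 1;
  for \<open>m > 1\<close> this compares \<open>omega m\<close> with \<open>269/97\<close>.\<close>

lemma h_ln:
  assumes "m > 0"
  shows "h (ln (real m)) = exp (ln (t m) - 538/97 * ln (real m))"
proof -
  have exp_diff_mult: "exp ((real k - s) * ln (real m)) = real m ^ k * exp (- (s * ln (real m)))" for k s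
  proof -
    have "(real k - s) * ln (real m) = real k * ln (real m) + - (s * ln (real m))"
      by (simp add: algebra_simps)
    then show ?thesis
      using assms by (simp only: exp_add exp_of_nat_mult) simp
  qed
  have "h (ln (real m)) = t m * exp (- (538/97 * ln (real m)))"
    unfolding h_def t_eq_sum sum_distrib_right exp_diff_mult by (simp only: mult.assoc)
  also have "\<dots> = exp (ln (t m) + - (538/97 * ln (real m)))"
    unfolding exp_add using t_pos[of m] by simp
  finally show ?thesis
    by simp
qed

lemma t_42: "t 42 = 1007595072" and t_44: "t 44 = 1303676064" and t_46: "t 46 = 1668908032"
  by (simp_all add: t_def)

text \<open>
  The fractions \<open>50/9\<close>, \<open>61/11\<close> and \<open>538/97\<close>, with \<open>538 = 8 * 61 + 50\<close> and
  \<open>97 = 8 * 11 + 9\<close>, are successive convergents of \<open>2 * omega 44\<close>; comparing the small powers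
  avoids evaluating the 97th one.
\<close>

lemma ln_less_by_convergents:
  fixes T x c d :: real
  assumes "0 < T" "0 < x" "T ^ 11 \<le> c * x ^ 61" "T ^ 9 \<le> d * x ^ 50" "0 \<le> c" "c ^ 8 * d < 1"
  shows "ln T < 538/97 * ln x"
proof -
  have "T ^ 97 = (T ^ 11) ^ 8 * T ^ 9"
    by (simp flip: power_mult power_add)
  also have "\<dots> \<le> (c * x ^ 61) ^ 8 * (d * x ^ 50)"
    using assms by (intro mult_mono power_mono) auto
  also have "\<dots> = (c ^ 8 * d) * x ^ 538"
    by (simp add: power_mult_distrib flip: power_mult power_add)
  also have "\<dots> < 1 * x ^ 538"
    using assms by (intro mult_strict_right_mono) auto
  finally have "ln (T ^ 97) < ln (x ^ 538)"
    using assms by (subst ln_less_cancel_iff) auto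
  then show ?thesis
    using assms by (simp add: ln_realpow)
qed

lemma ln_greater_by_convergents:
  fixes T x c d :: real
  assumes "0 < T" "0 < x" "c * x ^ 61 \<le> T ^ 11" "d * x ^ 50 \<le> T ^ 9"
    and "0 \<le> c" "0 \<le> d" "1 < c ^ 8 * d"
  shows "538/97 * ln x < ln T"
proof -
  have "1 * x ^ 538 < (c ^ 8 * d) * x ^ 538"
    using assms by (intro mult_strict_right_mono) auto
  also have "\<dots> = (c * x ^ 61) ^ 8 * (d * x ^ 50)"
    by (simp add: power_mult_distrib flip: power_mult power_add)
  also have "\<dots> \<le> (T ^ 11) ^ 8 * T ^ 9"
    using assms by (intro mult_mono power_mono) auto
  also have "\<dots> = T ^ 97"
    by (simp flip: power_mult power_add)
  finally have "ln (x ^ 538) < ln (T ^ 97)"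
    using assms by (subst ln_less_cancel_iff) auto
  then show ?thesis
    using assms by (simp add: ln_realpow)
qed

text \<open>The two constants are \<open>t 44 ^ 11 / 44 ^ 61\<close> and
  \<open>t 44 ^ 9 / 44 ^ 50\<close> rounded up to a few digits. At 42 and 46 the analogous ratios
  are rounded down. In all three cases \<open>c ^ 8 * d\<close> stays more than one percent away
  from 1.\<close>

lemma h_ln_44: "h (ln 44) < 1"
  using h_ln[of 44] ln_less_by_convergents[of "t 44" 44 "51907/50000" "731/1000"]
  by (simp add: t_44 power_divide)

lemma h_ln_42: "1 < h (ln 42)"
  using h_ln[of 42] ln_greater_by_convergents[of "t 42" 42 "10421/10000" "7363/10000"]
  by (simp add: t_42 power_divide)

lemma h_ln_46: "1 < h (ln 46)"
  using h_ln[of 46] ln_greater_by_convergents[of "t 46" 46 "2087/2000" "7311/10000"]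
  by (simp add: t_46 power_divide)

lemma h_ln_gt_1:
  assumes "m > 0" "even m" "m \<noteq> 44"
  shows "1 < h (ln (real m))"
proof -
  have "m \<noteq> 43" "m \<noteq> 45"
    using assms(2) by auto
  then consider "m \<le> 42" | "46 \<le> m"
    using assms(3) by linarith
  then show ?thesis
  proof cases
    case 1
    then have "ln 42 \<in> closed_segment (ln 44) (ln (real m))"
      using assms(1) by (auto simp: closed_segment_eq_real_ivl)
    then have "h (ln 42) \<le> h (ln (real m))"
      using h_ln_44 h_ln_42 by (intro convex_on_le_beyond[OF convex_h]) auto
    then show ?thesis
      using h_ln_42 by simp
  next
    case 2
    then have "ln 46 \<in> closed_segment (ln 44) (ln (real m))"
      by (auto simp: closed_segment_eq_real_ivl)
    then have "h (ln 46) \<le> h (ln (real m))"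
      using h_ln_44 h_ln_46 by (intro convex_on_le_beyond[OF convex_h]) auto
    then show ?thesis
      using h_ln_46 by simp
  qed
qed

lemma omega_eq:
  assumes "m > 0"
  shows "omega m = ln (t m) / (2 * ln (real m))"
  using assms by (simp add: omega_def log_def ln_realpow)

lemma omega_44_less: "omega 44 < 269/97"
proof -
  have "ln (t 44) < 538/97 * ln 44"
    using h_ln_44 h_ln[of 44] by simp
  then show ?thesis
    by (simp add: omega_eq pos_divide_less_eq)
qed

lemma omega_greater:
  assumes "m > 0" "even m" "m \<noteq> 44"
  shows "269/97 < omega m"
proof -
  have "m \<noteq> 1"
    using assms(2) by auto
  with assms(1) have "0 < ln (real m)"
    by simp
  moreover have "538/97 * ln (real m) < ln (t m)"
    using h_ln_gt_1[OF assms] h_ln[OF assms(1)] by simp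
  ultimately show ?thesis
    using assms(1) by (simp add: omega_eq pos_less_divide_eq)
qed

lemma ln_44_bounds: "ln 44 \<in> {3.7839..3.7845::real}"
proof -
  \<comment> \<open>This factorization of 44 leaves only logarithms of numbers near 1, for which
    four and two terms of the series suffice.\<close>
  have "ln (2 ^ 5 * (11/8)) = ln (2 ^ 5) + ln (11/8::real)"
    by (rule ln_mult_pos) auto
  then have "ln 44 = 5 * ln 2 + ln (11/8::real)"
    using ln_realpow[of 2 5] by simp
  moreover have "ln 2 \<in> {0.6931..0.69316::real}"
    using ln_approx_bounds[of 2 4] by (simp add: eval_nat_numeral)
  moreover have "ln (11/8) \<in> {0.3184..0.3186::real}"
    using ln_approx_bounds[of "11/8" 2] by (simp add: eval_nat_numeral)
  ultimately show ?thesis by simp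
qed

text \<open>
  Since \<open>t 44 ^ 11 / 44 ^ 61\<close> is close to 1, coarse bounds on its logarithm and on \<open>ln 44\<close>
  determine \<open>omega 44\<close> to six decimal places.
\<close>

lemma omega_44_bounds: "\<bar>10 ^ 6 * omega 44 - 2773177\<bar> < 1/2"
proof -
  define r :: real where "r = t 44 ^ 11 / 44 ^ 61"
  have r: "1.03813 \<le> r" "r \<le> 1.03814"
    by (simp_all add: r_def t_44)
  have "0.03741 \<le> ln (1.03813::real)"
    using ln_approx_bounds[of "1.03813" 1] by (simp add: eval_nat_numeral)
  also have "\<dots> \<le> ln r"
    using r by simp
  finally have lower: "0.03741 \<le> ln r" .
  have "ln r \<le> ln (1.03814::real)"
    using r by simp
  also have "\<dots> \<le> 0.03744"
    using ln_approx_bounds[of "1.03814" 1] by (simp add: eval_nat_numeral)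
  finally have upper: "ln r \<le> 0.03744" .
  have "ln (T ^ 11 / x ^ 61) = 11 * ln T - 61 * ln x" if "0 < T" "0 < x" for T x :: real
    using that by (simp add: ln_div ln_realpow)
  from this[OF t_pos, of 44 44] have "ln r = 11 * ln (t 44) - 61 * ln 44"
    unfolding r_def by simp
  then have "ln (t 44) = (61 * ln 44 + ln r) / 11"
    by simp
  \<comment> \<open>Here \<open>omega 44 = 61/22 + ln r / (22 * ln 44)\<close>, with a last term of
    about 0.00045. After clearing denominators both inequalities are linear in \<open>ln 44\<close>
    and \<open>ln r\<close>.\<close>
  with ln_44_bounds lower upper
  have "2773176.5 * (2 * ln 44) < 10 ^ 6 * ln (t 44)" "10 ^ 6 * ln (t 44) < 2773177.5 * (2 * ln 44)"
    by simp_all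
  then have "2773176.5 < 10 ^ 6 * omega 44" "10 ^ 6 * omega 44 < 2773177.5"
    by (simp_all add: omega_eq field_simps)
  then show ?thesis
    by linarith
qed

theorem corollary4p3:
  shows "is_arg_min omega (\<lambda>m. m > 0 \<and> even m \<and> m \<noteq> 16) 44
    \<and> (44::nat) ^ 2 = 1936
    \<and> omega 44 = log 1936 1303676064
    \<and> round (10 ^ 6 * omega 44) = 2773177"
proof (intro conjI)
  show "is_arg_min omega (\<lambda>m. m > 0 \<and> even m \<and> m \<noteq> 16) 44"
    unfolding is_arg_min_def
  proof (intro conjI notI)
    assume "\<exists>m. (m > 0 \<and> even m \<and> m \<noteq> 16) \<and> omega m < omega 44"
    then obtain m where "m > 0" "even m" "omega m < omega 44"
      by blast
    then show False
      using omega_44_less omega_greater[of m] by (cases "m = 44") simp_all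
  qed simp_all
  show "(44::nat) ^ 2 = 1936"
    by simp
  show "omega 44 = log 1936 1303676064"
    by (simp add: omega_def t_44)
  show "round (10 ^ 6 * omega 44) = 2773177"
    using omega_44_bounds by (intro round_unique') simp
qed

end
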